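(* Let $G$ be a finite simple graph with no isolated vertices that is $C_5$-free and not isomorphic to any of the following graphs: (1) $K_{2,m}$ for some $m\ge 2$; (2) the wheel consisting of a $4$-cycle plus one vertex adjacent to all four cycle vertices; (3) $K_{2,2,2}$; (4) $2K_2$; (5) the path $P_4$; (6) the gem, i.e. a path $P_4$ plus one vertex adjacent to all four path vertices; (7) the bowtie (two triangles sharing exactly one vertex). Then $G$ is threshold if and only if $G/e$ is threshold for every edge $e\in E(G)$.
   Context: All graphs are finite and simple. A graph is threshold if it has no induced subgraph isomorphic to $2K_2$ (two disjoint edges), the path $P_4$, or the cycle $C_4$. For an edge $e=uv$ of $G$, the contraction $G/e$ is obtained from $G$ by deleting $u$ and $v$ and adding a new vertex adjacent to every vertex of $(N(u)\cup N(v))\setminus\{u,v\}$. *)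

theory Defs
  imports "Graph_Theory.Graph_Theory"
begin

text \<open>
  A finite simple graph is a \<open>pair_graph\<close>: a finite, symmetric, loop-free set of ordered pairs.
  Each undirected edge \<open>uv\<close> therefore occurs twice, as the arcs \<open>(u, v)\<close> and \<open>(v, u)\<close>.
\<close>

abbreviation graph_iso :: "'a pair_pre_digraph \<Rightarrow> 'b pair_pre_digraph \<Rightarrow> bool" where
  "graph_iso G H \<equiv> digraph_iso (with_proj G) (with_proj H)"

definition has_induced :: "'b pair_pre_digraph \<Rightarrow> 'a pair_pre_digraph \<Rightarrow> bool" where
  "has_induced H G \<longleftrightarrow>
     (\<exists>H'. induced_subgraph (with_proj H') (with_proj G) \<and> graph_iso H' H)"

definition no_isolated_verts :: "'a pair_pre_digraph \<Rightarrow> bool" where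
  "no_isolated_verts G \<longleftrightarrow> (\<forall>v \<in> pverts G. \<exists>w. (v, w) \<in> parcs G)"

text \<open>The graph on the vertices \<open>0, \<dots>, n - 1\<close>, each edge being listed in one orientation only.\<close>

definition graph_on :: "nat \<Rightarrow> nat rel \<Rightarrow> nat pair_pre_digraph" where
  "graph_on n E = \<lparr> pverts = {..<n}, parcs = E \<union> E\<inverse> \<rparr>"

definition two_K2 :: "nat pair_pre_digraph" where
  "two_K2 = graph_on 4 {(0,1), (2,3)}"

definition path4 :: "nat pair_pre_digraph" where
  "path4 = graph_on 4 {(0,1), (1,2), (2,3)}"

definition cycle4 :: "nat pair_pre_digraph" where
  "cycle4 = graph_on 4 {(0,1), (1,2), (2,3), (3,0)}"

definition cycle5 :: "nat pair_pre_digraph" where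
  "cycle5 = graph_on 5 {(0,1), (1,2), (2,3), (3,4), (4,0)}"

definition wheel4 :: "nat pair_pre_digraph" where
  "wheel4 = graph_on 5 ({(0,1), (1,2), (2,3), (3,0)} \<union> {0,1,2,3} \<times> {4})"

definition gem :: "nat pair_pre_digraph" where
  "gem = graph_on 5 ({(0,1), (1,2), (2,3)} \<union> {0,1,2,3} \<times> {4})"

definition bowtie :: "nat pair_pre_digraph" where
  "bowtie = graph_on 5 {(0,1), (1,4), (4,0), (2,3), (3,4), (4,2)}"

definition K222 :: "nat pair_pre_digraph" where
  "K222 = graph_on 6 ({0,1} \<times> {2,3} \<union> {0,1} \<times> {4,5} \<union> {2,3} \<times> {4,5})"

definition threshold_graph :: "'a pair_pre_digraph \<Rightarrow> bool" where
  "threshold_graph G \<longleftrightarrow>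
     \<not> has_induced two_K2 G \<and> \<not> has_induced path4 G \<and> \<not> has_induced cycle4 G"

text \<open>
  In the contraction of \<open>uv\<close> the new vertex is \<open>None\<close>, and a remaining vertex \<open>x\<close> of \<open>G\<close>
  appears as \<open>Some x\<close>.
\<close>

definition contract_edge :: "'a pair_pre_digraph \<Rightarrow> 'a \<Rightarrow> 'a \<Rightarrow> 'a option pair_pre_digraph" where
  "contract_edge G u v =
     (let N = Some ` (parcs G `` {u, v} - {u, v}) in
      \<lparr> pverts = insert None (Some ` (pverts G - {u, v})),
        parcs = {(Some x, Some y) | x y. (x, y) \<in> parcs G \<and> x \<notin> {u, v} \<and> y \<notin> {u, v}}
                \<union> {None} \<times> N \<union> N \<times> {None} \<rparr>)"

end

theory Submission
  imports Defs
begin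

text \<open>
  A graph is threshold iff it has no alternating 4-cycle: distinct \<open>a, b, c, d\<close> with edges \<open>ab\<close>, \<open>cd\<close>
  and non-edges \<open>ac\<close>, \<open>bd\<close>; the two remaining pairs decide between \<open>2K\<^sub>2\<close>, \<open>P\<^sub>4\<close> and \<open>C\<^sub>4\<close>.

  If \<open>G\<close> is threshold and \<open>uv\<close> is an edge, one of the neighbourhoods of \<open>u\<close> and \<open>v\<close> contains the
  other, so \<open>G/uv\<close> is \<open>G\<close> with one vertex deleted.

  Conversely, let all contractions be threshold and let \<open>abcd\<close> be an alternating 4-cycle. Contracting
  an edge outside it leaves it intact, so the other vertices are independent. Contracting an edge
  \<open>ax\<close> with \<open>x\<close> outside shows that \<open>x\<close> is adjacent to both or to none of \<open>a, c\<close>, and likewise for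
  \<open>b, d\<close>. Since this applies to every alternating 4-cycle, few configurations of outer vertices
  survive, and they are exactly the exceptional graphs.
\<close>

section \<open>Isomorphism with a concrete graph\<close>

text \<open>A library isomorphism maps vertices and arcs separately and also carries the new head
  and tail functions. For pair graphs the latter are projections, so the arc map is determined by
  the vertex map and only \<open>f\<close> remains. Well-formedness of \<open>G\<close> is part of
  the library notion and so has to appear on the right.\<close>

lemma graph_iso_iff:
  "graph_iso G H \<longleftrightarrow> pair_wf_digraph G \<and>
     (\<exists>f. inj_on f (pverts G) \<and> pverts H = f ` pverts G \<and> parcs H = map_prod f f ` parcs G)"
proof
  assume "graph_iso G H"
  then obtain h where h: "pre_digraph.digraph_isomorphism (with_proj G) h"
    and H: "with_proj H = app_iso h (with_proj G)"
    by (auto simp: digraph_iso_def)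
  have *: "iso_verts h ` pverts G = pverts H" "iso_arcs h ` parcs G = parcs H"
    "iso_tail h = fst" "iso_head h = snd"
    using H by (simp_all add: with_proj_def app_iso_def)
  have wf: "pair_wf_digraph G" and inj: "inj_on (iso_verts h) (pverts G)"
    and ends: "\<And>e. e \<in> parcs G \<Longrightarrow> iso_arcs h e = map_prod (iso_verts h) (iso_verts h) e"
    using h unfolding pre_digraph.digraph_isomorphism_def
    by (auto simp: wf_digraph_wp_iff * map_prod_def prod_eq_iff split: prod.splits)
  have "parcs H = map_prod (iso_verts h) (iso_verts h) ` parcs G"
    using *(2) ends by (metis (no_types, lifting) image_cong)
  then show "pair_wf_digraph G \<and> (\<exists>f. inj_on f (pverts G) \<and> pverts H = f ` pverts G \<and>
      parcs H = map_prod f f ` parcs G)"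
    using wf inj *(1) by blast
next
  assume "pair_wf_digraph G \<and> (\<exists>f. inj_on f (pverts G) \<and> pverts H = f ` pverts G \<and>
      parcs H = map_prod f f ` parcs G)"
  then obtain f where wf: "pair_wf_digraph G" and f: "inj_on f (pverts G)"
    "pverts H = f ` pverts G" "parcs H = map_prod f f ` parcs G"
    by blast
  define h where
    "h = \<lparr>iso_verts = f, iso_arcs = map_prod f f, iso_head = snd, iso_tail = fst\<rparr>"
  have "parcs G \<subseteq> pverts G \<times> pverts G"
    using wf by (auto dest: pair_wf_digraph.in_arcsD1 pair_wf_digraph.in_arcsD2)
  then have "inj_on (map_prod f f) (parcs G)"
    using map_prod_inj_on[OF f(1) f(1)] by (rule inj_on_subset[rotated])
  then have "pre_digraph.digraph_isomorphism (with_proj G) h"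
    using wf f(1) unfolding pre_digraph.digraph_isomorphism_def
    by (auto simp: h_def wf_digraph_wp_iff)
  moreover have "with_proj H = app_iso h (with_proj G)"
    using f by (simp add: with_proj_def app_iso_def h_def)
  ultimately show "graph_iso G H"
    by (auto simp: digraph_iso_def)
qed

text \<open>An isomorphism onto a graph on \<open>{..<n}\<close> amounts to an enumeration of the
  vertices: position \<open>i\<close> of \<open>vs\<close> holds the preimage of \<open>i\<close>.
  Concrete isomorphisms can then be given as explicit lists.\<close>

lemma graph_iso_graph_on_iff:
  assumes wf: "pair_wf_digraph G" and E: "E \<subseteq> {..<n} \<times> {..<n}"
  shows "graph_iso G (graph_on n E) \<longleftrightarrow>
    (\<exists>vs. distinct vs \<and> length vs = n \<and> set vs = pverts G \<and>
      (\<forall>i<n. \<forall>j<n. (vs ! i, vs ! j) \<in> parcs G \<longleftrightarrow> (i, j) \<in> E \<union> E\<inverse>))"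
    (is "_ \<longleftrightarrow> (\<exists>vs. ?P vs)")
proof
  assume "graph_iso G (graph_on n E)"
  then obtain f where f: "inj_on f (pverts G)" "{..<n} = f ` pverts G"
    and arcs: "E \<union> E\<inverse> = map_prod f f ` parcs G"
    unfolding graph_iso_iff graph_on_def by auto
  define vs where "vs = map (the_inv_into (pverts G) f) [0..<n]"
  have nth: "vs ! i \<in> pverts G" "f (vs ! i) = i" if "i < n" for i
    using that f the_inv_into_into[OF f(1), of i] f_the_inv_into_f[OF f(1), of i]
    by (auto simp: vs_def)
  have len: "length vs = n" by (simp add: vs_def)
  have "distinct vs"
    unfolding distinct_conv_nth using nth len by metis
  moreover have "set vs = pverts G"
    using bij_betw_the_inv_into[of f "pverts G" "{..<n}"] f
    by (simp add: vs_def bij_betw_def atLeast0LessThan)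
  moreover have "(vs ! i, vs ! j) \<in> parcs G \<longleftrightarrow> (i, j) \<in> E \<union> E\<inverse>" if "i < n" "j < n" for i j
  proof
    assume "(vs ! i, vs ! j) \<in> parcs G"
    then have "map_prod f f (vs ! i, vs ! j) \<in> E \<union> E\<inverse>"
      unfolding arcs by (rule imageI)
    then show "(i, j) \<in> E \<union> E\<inverse>" using nth that by simp
  next
    assume "(i, j) \<in> E \<union> E\<inverse>"
    then obtain x y where xy: "(x, y) \<in> parcs G" "f x = i" "f y = j"
      unfolding arcs by auto
    then have "x \<in> pverts G" "y \<in> pverts G"
      using wf by (auto dest: pair_wf_digraph.in_arcsD1 pair_wf_digraph.in_arcsD2)
    then have "x = vs ! i" "y = vs ! j"
      using xy nth that f(1) by (metis inj_onD)+
    then show "(vs ! i, vs ! j) \<in> parcs G" using xy by simp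
  qed
  ultimately show "\<exists>vs. ?P vs" using len by blast
next
  assume "\<exists>vs. ?P vs"
  then obtain vs where vs: "?P vs" by blast
  define f where "f = the_inv_into {..<n} ((!) vs)"
  have inj: "inj_on ((!) vs) {..<n}"
    using vs by (auto intro: inj_on_nth)
  have im: "(!) vs ` {..<n} = pverts G"
    using vs by (auto simp: set_conv_nth)
  have bij: "bij_betw f (pverts G) {..<n}"
    unfolding f_def im[symmetric] using bij_betw_the_inv_into[of "(!) vs" "{..<n}"] inj
    by (simp add: bij_betw_def)
  have f: "f (vs ! i) = i" if "i < n" for i
    unfolding f_def using the_inv_into_f_f[OF inj] that by simp
  have "E \<union> E\<inverse> = map_prod f f ` parcs G"
  proof (intro equalityI subsetI)
    fix e assume e: "e \<in> E \<union> E\<inverse>"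
    obtain i j where ij: "e = (i, j)" by fastforce
    then have "i < n" "j < n" using e E by auto
    then have "(vs ! i, vs ! j) \<in> parcs G" "map_prod f f (vs ! i, vs ! j) = e"
      using e ij vs f by auto
    then show "e \<in> map_prod f f ` parcs G" by force
  next
    fix e assume "e \<in> map_prod f f ` parcs G"
    then obtain x y where xy: "(x, y) \<in> parcs G" "e = (f x, f y)" by auto
    then have "x \<in> pverts G" "y \<in> pverts G"
      using wf by (auto dest: pair_wf_digraph.in_arcsD1 pair_wf_digraph.in_arcsD2)
    then obtain i j where "i < n" "j < n" "x = vs ! i" "y = vs ! j"
      unfolding im[symmetric] by blast
    then show "e \<in> E \<union> E\<inverse>" using xy f vs by auto
  qed
  then show "graph_iso G (graph_on n E)"
    using wf bij unfolding graph_iso_iff graph_on_def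
    by (auto simp: bij_betw_def intro!: exI[of _ f])
qed

lemma has_induced_graph_on_iff:
  assumes wf: "pair_wf_digraph G" and E: "E \<subseteq> {..<n} \<times> {..<n}"
  shows "has_induced (graph_on n E) G \<longleftrightarrow>
    (\<exists>vs. distinct vs \<and> length vs = n \<and> set vs \<subseteq> pverts G \<and>
      (\<forall>i<n. \<forall>j<n. (vs ! i, vs ! j) \<in> parcs G \<longleftrightarrow> (i, j) \<in> E \<union> E\<inverse>))"
    (is "_ \<longleftrightarrow> (\<exists>vs. ?P vs)")
proof
  assume "has_induced (graph_on n E) G"
  then obtain H where H: "induced_subgraph (with_proj H) (with_proj G)"
    "graph_iso H (graph_on n E)"
    by (auto simp: has_induced_def)
  have wfH: "pair_wf_digraph H" using H(2) by (simp add: graph_iso_iff)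
  have sub: "pverts H \<subseteq> pverts G"
    and arcs: "\<And>x y. x \<in> pverts H \<Longrightarrow> y \<in> pverts H \<Longrightarrow> (x, y) \<in> parcs H \<longleftrightarrow> (x, y) \<in> parcs G"
    using H(1) by (auto simp: induced_subgraph_def subgraph_def)
  obtain vs where "distinct vs" "length vs = n" "set vs = pverts H"
    "\<forall>i<n. \<forall>j<n. (vs ! i, vs ! j) \<in> parcs H \<longleftrightarrow> (i, j) \<in> E \<union> E\<inverse>"
    using H(2) unfolding graph_iso_graph_on_iff[OF wfH E] by blast
  moreover from this have "\<forall>i<n. \<forall>j<n. (vs ! i, vs ! j) \<in> parcs G \<longleftrightarrow> (i, j) \<in> E \<union> E\<inverse>"
    using arcs nth_mem by metis
  ultimately show "\<exists>vs. ?P vs" using sub by blast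
next
  assume "\<exists>vs. ?P vs"
  then obtain vs where vs: "?P vs" by blast
  define H where "H = \<lparr>pverts = set vs, parcs = parcs G \<inter> set vs \<times> set vs\<rparr>"
  have wfH: "pair_wf_digraph H"
    by unfold_locales (auto simp: H_def)
  have "induced_subgraph (with_proj H) (with_proj G)"
    using wf wfH vs
    by (auto simp: induced_subgraph_def subgraph_def wf_digraph_wp_iff compatible_def H_def)
  moreover have "graph_iso H (graph_on n E)"
    unfolding graph_iso_graph_on_iff[OF wfH E] using vs
    by (intro exI[of _ vs]) (auto simp: H_def)
  ultimately show "has_induced (graph_on n E) G"
    by (auto simp: has_induced_def)
qed

text \<open>Symmetry and the absence of loops leave only the pairs with \<open>i < j\<close> to
  check, which keeps the later verifications for explicit lists small.\<close>

lemma (in pair_graph) graph_iso_graph_onI: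
  assumes "distinct vs" "length vs = n" "set vs = pverts G" "E \<subseteq> {..<n} \<times> {..<n}" "irrefl E"
    and "\<forall>j<n. \<forall>i<j. (vs ! i, vs ! j) \<in> parcs G \<longleftrightarrow> (i, j) \<in> E \<union> E\<inverse>"
  shows "graph_iso G (graph_on n E)"
proof -
  have "(vs ! i, vs ! j) \<in> parcs G \<longleftrightarrow> (i, j) \<in> E \<union> E\<inverse>" if "i < n" "j < n" for i j
  proof (cases i j rule: linorder_cases)
    case less
    then show ?thesis using assms(6) that by blast
  next
    case equal
    then show ?thesis using no_loops' assms(5) by (auto simp: irrefl_def)
  next
    case greater
    then have "(vs ! j, vs ! i) \<in> parcs G \<longleftrightarrow> (j, i) \<in> E \<union> E\<inverse>"
      using assms(6) that by blast
    then show ?thesis using arcs_symmetric by blast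
  qed
  then show ?thesis
    using assms graph_iso_graph_on_iff[OF pair_wf_digraph assms(4)] by blast
qed

section \<open>Alternating 4-cycles\<close>

definition alternating_4cycle :: "'a pair_pre_digraph \<Rightarrow> 'a \<Rightarrow> 'a \<Rightarrow> 'a \<Rightarrow> 'a \<Rightarrow> bool" where
  "alternating_4cycle G a b c d \<longleftrightarrow>
     (a, b) \<in> parcs G \<and> (c, d) \<in> parcs G \<and> (a, c) \<notin> parcs G \<and> (b, d) \<notin> parcs G \<and> a \<noteq> c \<and> b \<noteq> d"

context pair_graph
begin

lemma adj_sym: "(x, y) \<in> parcs G \<longleftrightarrow> (y, x) \<in> parcs G"
  using arcs_symmetric by blast

lemma adj_irrefl: "(x, x) \<notin> parcs G"
  using no_loops' by blast

text \<open>The first symmetry exchanges the roles of the non-edges \<open>ac\<close> and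
  \<open>bd\<close> and of the undetermined pairs \<open>ad\<close> and \<open>bc\<close>; the
  second turns the cycle by a half. Together they let later arguments treat one case of each
  kind.\<close>

lemma alternating_4cycle_rotate:
  "alternating_4cycle G a b c d \<Longrightarrow> alternating_4cycle G b a d c"
  "alternating_4cycle G a b c d \<Longrightarrow> alternating_4cycle G c d a b"
  unfolding alternating_4cycle_def by (auto simp: adj_sym)

text \<open>Edges have distinct ends; \<open>a = d\<close> would turn the edge \<open>cd\<close>
  into the non-edge \<open>ac\<close>, and \<open>b = c\<close> would do the same to the edge
  \<open>ab\<close>.\<close>

lemma alternating_4cycle_distinct:
  "alternating_4cycle G a b c d \<Longrightarrow> distinct [a, b, c, d]"
  unfolding alternating_4cycle_def using adj_irrefl adj_sym by (auto 4 4)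

lemma alternating_4cycle_verts:
  "alternating_4cycle G a b c d \<Longrightarrow> {a, b, c, d} \<subseteq> pverts G"
  unfolding alternating_4cycle_def using in_arcsD1 in_arcsD2 by auto

lemma threshold_graph_iff_no_alternating_4cycle:
  "threshold_graph G \<longleftrightarrow> (\<nexists>a b c d. alternating_4cycle G a b c d)"
proof
  assume th: "threshold_graph G"
  show "\<nexists>a b c d. alternating_4cycle G a b c d"
  proof
    assume "\<exists>a b c d. alternating_4cycle G a b c d"
    then obtain a b c d where alt: "alternating_4cycle G a b c d" by blast
    note facts = alternating_4cycle_distinct[OF alt] alternating_4cycle_verts[OF alt]
      alt[unfolded alternating_4cycle_def]
    note adj = adj_irrefl adj_sym[of b a] adj_sym[of c a] adj_sym[of d] adj_sym[of c b]
    consider "(a, d) \<in> parcs G" "(b, c) \<in> parcs G" | "(a, d) \<in> parcs G" "(b, c) \<notin> parcs G"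
      | "(a, d) \<notin> parcs G" "(b, c) \<in> parcs G" | "(a, d) \<notin> parcs G" "(b, c) \<notin> parcs G"
      by blast
    then have "has_induced cycle4 G \<or> has_induced path4 G \<or> has_induced two_K2 G"
    proof cases
      case 1
      then have "has_induced cycle4 G"
        unfolding cycle4_def using facts
        by (subst has_induced_graph_on_iff[OF pair_wf_digraph], simp, intro exI[of _ "[a, b, c, d]"])
          (auto simp: less_Suc_eq numeral_eq_Suc adj)
      then show ?thesis by blast
    next
      case 2
      then have "has_induced path4 G"
        unfolding path4_def using facts
        \<comment> \<open>With \<open>ad\<close> present and \<open>bc\<close> absent the path runs
          b-a-d-c; the list follows its order.\<close>
        by (subst has_induced_graph_on_iff[OF pair_wf_digraph], simp, intro exI[of _ "[b, a, d, c]"])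
          (auto simp: less_Suc_eq numeral_eq_Suc adj)
      then show ?thesis by blast
    next
      case 3
      then have "has_induced path4 G"
        unfolding path4_def using facts
        by (subst has_induced_graph_on_iff[OF pair_wf_digraph], simp, intro exI[of _ "[a, b, c, d]"])
          (auto simp: less_Suc_eq numeral_eq_Suc adj)
      then show ?thesis by blast
    next
      case 4
      then have "has_induced two_K2 G"
        unfolding two_K2_def using facts
        by (subst has_induced_graph_on_iff[OF pair_wf_digraph], simp, intro exI[of _ "[a, b, c, d]"])
          (auto simp: less_Suc_eq numeral_eq_Suc adj)
      then show ?thesis by blast
    qed
    with th show False by (simp add: threshold_graph_def)
  qed
next
  assume no: "\<nexists>a b c d. alternating_4cycle G a b c d"
  \<comment> \<open>In the given numberings all three forbidden graphs have the edges 01, 23 and the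
    non-edges 02, 13, so one claim about \<open>E\<close> covers them.\<close>
  have "\<not> has_induced (graph_on 4 E) G"
    if E: "E \<subseteq> {..<4} \<times> {..<4}" "(0, 1) \<in> E" "(2, 3) \<in> E"
      "(0, 2) \<notin> E \<union> E\<inverse>" "(1, 3) \<notin> E \<union> E\<inverse>" for E
  proof
    assume "has_induced (graph_on 4 E) G"
    then obtain vs where vs: "distinct vs" "length vs = 4"
      "\<forall>i<4. \<forall>j<4. (vs ! i, vs ! j) \<in> parcs G \<longleftrightarrow> (i, j) \<in> E \<union> E\<inverse>"
      unfolding has_induced_graph_on_iff[OF pair_wf_digraph E(1)] by blast
    have "alternating_4cycle G (vs ! 0) (vs ! 1) (vs ! 2) (vs ! 3)"
      unfolding alternating_4cycle_def using vs E(2-) by (simp add: nth_eq_iff_index_eq)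
    with no show False by blast
  qed
  then show "threshold_graph G"
    unfolding threshold_graph_def two_K2_def path4_def cycle4_def by simp
qed

end

section \<open>Contractions\<close>

lemma parcs_contract_edge:
  "(Some x, Some y) \<in> parcs (contract_edge G u v) \<longleftrightarrow>
     (x, y) \<in> parcs G \<and> x \<notin> {u, v} \<and> y \<notin> {u, v}"
  "(None, Some x) \<in> parcs (contract_edge G u v) \<longleftrightarrow>
     ((u, x) \<in> parcs G \<or> (v, x) \<in> parcs G) \<and> x \<notin> {u, v}"
  "(Some x, None) \<in> parcs (contract_edge G u v) \<longleftrightarrow>
     ((u, x) \<in> parcs G \<or> (v, x) \<in> parcs G) \<and> x \<notin> {u, v}"
  "(None, None) \<notin> parcs (contract_edge G u v)"
  by (auto simp: contract_edge_def Let_def)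

lemma (in pair_graph) pair_graph_contract_edge: "pair_graph (contract_edge G u v)"
proof
  fix e assume "e \<in> parcs (contract_edge G u v)"
  then show "fst e \<in> pverts (contract_edge G u v)" "snd e \<in> pverts (contract_edge G u v)"
    using in_arcsD1 in_arcsD2 by (auto simp: contract_edge_def Let_def)
  show "fst e \<noteq> snd e"
    using \<open>e \<in> _\<close> adj_irrefl by (cases e; cases "fst e"; cases "snd e") (auto simp: parcs_contract_edge)
next
  show fin: "finite (pverts (contract_edge G u v))"
    using pair_finite_verts by (simp add: contract_edge_def Let_def)
  have "parcs (contract_edge G u v) \<subseteq> pverts (contract_edge G u v) \<times> pverts (contract_edge G u v)"
    using in_arcsD1 in_arcsD2 by (auto simp: contract_edge_def Let_def)
  then show "finite (parcs (contract_edge G u v))"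
    using fin by (meson finite_SigmaI finite_subset)
next
  show "symmetric (with_proj (contract_edge G u v))"
    unfolding symmetric_def with_proj_simps
  proof (rule symI)
    fix x y assume "(x, y) \<in> parcs (contract_edge G u v)"
    then show "(y, x) \<in> parcs (contract_edge G u v)"
      by (cases x; cases y) (auto simp: parcs_contract_edge adj_sym)
  qed
qed

lemma (in pair_graph) threshold_contract_edge:
  assumes th: "threshold_graph G" and uv: "(u, v) \<in> parcs G"
  shows "threshold_graph (contract_edge G u v)"
proof -
  interpret C: pair_graph "contract_edge G u v" by (rule pair_graph_contract_edge)
  have no: "\<not> alternating_4cycle G a b c d" for a b c d
    using th by (simp add: threshold_graph_iff_no_alternating_4cycle)
  have "(\<forall>x. (u, x) \<in> parcs G \<and> x \<noteq> v \<longrightarrow> (v, x) \<in> parcs G) \<or>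
        (\<forall>x. (v, x) \<in> parcs G \<and> x \<noteq> u \<longrightarrow> (u, x) \<in> parcs G)"
  proof (rule ccontr)
    assume "\<not> ?thesis"
    then obtain p q where "(u, p) \<in> parcs G" "p \<noteq> v" "(v, p) \<notin> parcs G"
      "(v, q) \<in> parcs G" "q \<noteq> u" "(u, q) \<notin> parcs G"
      by blast
    \<comment> \<open>A private neighbour \<open>p\<close> of \<open>u\<close> and a private
      neighbour \<open>q\<close> of \<open>v\<close> give the edges \<open>up\<close>,
      \<open>qv\<close> and the non-edges \<open>uq\<close>, \<open>pv\<close>.\<close>
    then have "alternating_4cycle G u p q v"
      by (auto simp: alternating_4cycle_def adj_sym)
    then show False using no by blast
  qed
  then obtain w where w: "w \<in> {u, v}"
    "\<And>x. x \<notin> {u, v} \<Longrightarrow> (w, x) \<in> parcs G \<longleftrightarrow> (u, x) \<in> parcs G \<or> (v, x) \<in> parcs G"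
    by blast
  \<comment> \<open>The end \<open>w\<close> with the larger neighbourhood stands in for the
    contracted vertex. Since neither \<open>u\<close> nor \<open>v\<close> survives as a
    \<open>Some\<close>, \<open>f\<close> embeds the contraction into \<open>G\<close> as an induced
    subgraph, and alternating 4-cycles carry over to \<open>G\<close>.\<close>
  define f where "f = case_option w id"
  have vert: "x \<in> insert None (Some ` (- {u, v}))" if "x \<in> pverts (contract_edge G u v)" for x
    using that by (auto simp: contract_edge_def Let_def)
  have arc: "(f x, f y) \<in> parcs G \<longleftrightarrow> (x, y) \<in> parcs (contract_edge G u v)"
    if "x \<in> pverts (contract_edge G u v)" "y \<in> pverts (contract_edge G u v)" for x y
    using vert[OF that(1)] vert[OF that(2)] w(2)
    by (auto simp: f_def parcs_contract_edge adj_irrefl adj_sym[of _ w])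
  have inj: "f x = f y \<longleftrightarrow> x = y"
    if "x \<in> pverts (contract_edge G u v)" "y \<in> pverts (contract_edge G u v)" for x y
    using vert[OF that(1)] vert[OF that(2)] w(1) by (auto simp: f_def)
  have "\<not> alternating_4cycle (contract_edge G u v) a b c d" for a b c d
  proof
    assume alt: "alternating_4cycle (contract_edge G u v) a b c d"
    then have "{a, b, c, d} \<subseteq> pverts (contract_edge G u v)"
      by (rule C.alternating_4cycle_verts)
    then have "alternating_4cycle G (f a) (f b) (f c) (f d)"
      using alt by (simp add: alternating_4cycle_def arc inj)
    then show False using no by blast
  qed
  then show ?thesis by (simp add: C.threshold_graph_iff_no_alternating_4cycle)
qed

section \<open>Outer vertices of an alternating 4-cycle when all contractions are threshold\<close>

locale contractions_threshold = pair_graph +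
  assumes contractions: "(u, v) \<in> parcs G \<Longrightarrow> threshold_graph (contract_edge G u v)"
begin

lemma contraction_no_alternating_4cycle:
  "(u, v) \<in> parcs G \<Longrightarrow> \<not> alternating_4cycle (contract_edge G u v) a b c d"
  using contractions pair_graph.threshold_graph_iff_no_alternating_4cycle[OF pair_graph_contract_edge]
  by blast

lemma outside_independent:
  assumes "alternating_4cycle G a b c d" "x \<notin> {a, b, c, d}" "y \<notin> {a, b, c, d}"
  shows "(x, y) \<notin> parcs G"
proof
  assume "(x, y) \<in> parcs G"
  moreover have "alternating_4cycle (contract_edge G x y) (Some a) (Some b) (Some c) (Some d)"
    using assms by (auto simp: alternating_4cycle_def parcs_contract_edge)
  ultimately show False using contraction_no_alternating_4cycle by blast
qed

text \<open>Otherwise the vertex contracted from \<open>xa\<close> could replace \<open>a\<close>: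
  it inherits the edge to \<open>b\<close>, and it misses \<open>c\<close> because both
  \<open>x\<close> and \<open>a\<close> do.\<close>

lemma outside_adj_imp:
  assumes alt: "alternating_4cycle G a b c d" and x: "x \<notin> {a, b, c, d}" and xa: "(x, a) \<in> parcs G"
  shows "(x, c) \<in> parcs G"
proof (rule ccontr)
  assume "(x, c) \<notin> parcs G"
  then have "alternating_4cycle (contract_edge G x a) None (Some b) (Some c) (Some d)"
    using alt x alternating_4cycle_distinct[OF alt]
    by (auto simp: alternating_4cycle_def parcs_contract_edge)
  then show False using contraction_no_alternating_4cycle xa by blast
qed

text \<open>The four implications come from reading the same alternating 4-cycle in its four
  symmetric ways.\<close>

lemma outside_adj_iff:
  assumes alt: "alternating_4cycle G a b c d" and x: "x \<notin> {a, b, c, d}"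
  shows "(x, a) \<in> parcs G \<longleftrightarrow> (x, c) \<in> parcs G" "(x, b) \<in> parcs G \<longleftrightarrow> (x, d) \<in> parcs G"
proof -
  note alt' = alt alternating_4cycle_rotate[OF alt]
    alternating_4cycle_rotate(2)[OF alternating_4cycle_rotate(1)[OF alt]]
  show "(x, a) \<in> parcs G \<longleftrightarrow> (x, c) \<in> parcs G" "(x, b) \<in> parcs G \<longleftrightarrow> (x, d) \<in> parcs G"
    using alt'[THEN outside_adj_imp] x by blast+
qed

text \<open>Some neighbour of \<open>x\<close> exists and, by independence, lies on the cycle; a
  neighbour \<open>c\<close> or \<open>d\<close> can be traded for \<open>a\<close> or
  \<open>b\<close>.\<close>

lemma outside_cases:
  assumes alt: "alternating_4cycle G a b c d" and iso: "no_isolated_verts G"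
    and x: "x \<in> pverts G" "x \<notin> {a, b, c, d}"
  shows "(x, a) \<in> parcs G \<or> (x, b) \<in> parcs G"
proof -
  obtain w where w: "(x, w) \<in> parcs G"
    using iso x(1) by (auto simp: no_isolated_verts_def)
  then have "w \<in> {a, b, c, d}"
    using outside_independent[OF alt x(2)] by blast
  then show ?thesis using w outside_adj_iff[OF alt x(2)] by blast
qed

section \<open>Alternating 4-cycles that induce a 4-cycle\<close>

text \<open>If one outer vertex sees only the opposite pair \<open>a, c\<close>, then no outer
  vertex sees \<open>b\<close>: such a \<open>y\<close> would yield another alternating 4-cycle with
  two adjacent vertices outside it, namely \<open>d, y\<close> if \<open>y\<close> sees
  \<open>a\<close>, and \<open>c, d\<close> if not.\<close>

lemma cycle4_outside_uniform:
  assumes alt: "alternating_4cycle G a b c d" and ad: "(a, d) \<in> parcs G" and bc: "(b, c) \<in> parcs G"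
    and x: "x \<notin> {a, b, c, d}" "(x, a) \<in> parcs G" "(x, b) \<notin> parcs G"
    and y: "y \<notin> {a, b, c, d}"
  shows "(y, b) \<notin> parcs G"
proof
  assume yb: "(y, b) \<in> parcs G"
  note abcd = alt[unfolded alternating_4cycle_def] alternating_4cycle_distinct[OF alt]
  show False
  proof (cases "(y, a) \<in> parcs G")
    case True
    have "alternating_4cycle G a x c b"
      using abcd x bc by (auto simp: alternating_4cycle_def adj_sym)
    moreover have "d \<notin> {a, x, c, b}" "y \<notin> {a, x, c, b}"
      using abcd x y yb by auto
    moreover have "(d, y) \<in> parcs G"
      using yb outside_adj_iff[OF alt y] adj_sym by blast
    ultimately show False using outside_independent by blast
  next
    case False
    have "alternating_4cycle G x a b y"
      using abcd x y yb False by (auto simp: alternating_4cycle_def adj_sym)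
    moreover have "c \<notin> {x, a, b, y}" "d \<notin> {x, a, b, y}"
      using abcd x y by auto
    ultimately show False using outside_independent abcd by blast
  qed
qed

text \<open>The sides are \<open>{a, c}\<close> and all remaining vertices. Outer vertices miss
  \<open>b\<close> and hence \<open>d\<close>, so they see \<open>a\<close> and \<open>c\<close>;
  the second side is independent and contains \<open>b\<close> and \<open>d\<close>, whence its size
  is at least 2.\<close>

lemma cycle4_complete_bipartite:
  assumes alt: "alternating_4cycle G a b c d" and ad: "(a, d) \<in> parcs G" and bc: "(b, c) \<in> parcs G"
    and iso: "no_isolated_verts G"
    and out: "\<And>x. x \<in> pverts G \<Longrightarrow> x \<notin> {a, b, c, d} \<Longrightarrow> (x, b) \<notin> parcs G"
  shows "\<exists>m\<ge>2. complete_bipartite_digraph 2 m (with_proj G)"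
proof -
  define V where "V = pverts G - {a, c}"
  note abcd = alt[unfolded alternating_4cycle_def] alternating_4cycle_distinct[OF alt]
  have sub: "{a, b, c, d} \<subseteq> pverts G" by (rule alternating_4cycle_verts[OF alt])
  have fin: "finite V" using pair_finite_verts by (simp add: V_def)
  have adj: "(x, a) \<in> parcs G" "(x, c) \<in> parcs G" if "x \<in> V" for x
  proof -
    have "(x, a) \<in> parcs G \<and> (x, c) \<in> parcs G"
    proof (cases "x \<in> {b, d}")
      case True
      then show ?thesis using abcd ad bc by (auto simp: adj_sym)
    next
      case False
      then have "x \<in> pverts G" "x \<notin> {a, b, c, d}" using that by (auto simp: V_def)
      then show ?thesis
        using outside_cases[OF alt iso] out outside_adj_iff(1)[OF alt] by blast
    qed
    then show "(x, a) \<in> parcs G" "(x, c) \<in> parcs G" by auto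
  qed
  have nadj: "(x, y) \<notin> parcs G" if "x \<in> V" "y \<in> V" for x y
  proof -
    have nb: "(z, b) \<notin> parcs G \<and> (z, d) \<notin> parcs G" if "z \<in> V" for z
      using that out[of z] outside_adj_iff(2)[OF alt, of z] abcd
      by (cases "z \<in> {b, d}") (auto simp: V_def adj_irrefl adj_sym)
    have "x \<in> {b, d} \<or> y \<in> {b, d} \<or> x \<notin> {a, b, c, d} \<and> y \<notin> {a, b, c, d}"
      using that by (auto simp: V_def)
    then show ?thesis
      using nb that outside_independent[OF alt] adj_sym by blast
  qed
  have "pverts G = {a, c} \<union> V" "{a, c} \<inter> V = {}" "card {a, c} = 2"
    using sub abcd by (auto simp: V_def)
  moreover have "parcs G = {a, c} \<times> V \<union> V \<times> {a, c}"
  proof (intro equalityI subsetI)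
    fix e assume e: "e \<in> parcs G"
    obtain x y where xy: "e = (x, y)" by fastforce
    have "x \<in> pverts G" "y \<in> pverts G" using e xy in_arcsD1 in_arcsD2 by auto
    moreover have "\<not> (x \<in> {a, c} \<and> y \<in> {a, c})" using e xy abcd adj_irrefl adj_sym by auto
    ultimately show "e \<in> {a, c} \<times> V \<union> V \<times> {a, c}"
      using nadj e xy by (auto simp: V_def)
  qed (use adj adj_sym in auto)
  ultimately have "complete_bipartite_digraph 2 (card V) (with_proj G)"
    unfolding complete_bipartite_digraph_pair_def using pair_finite_verts by blast
  moreover have "card {b, d} \<le> card V"
    using fin sub abcd by (intro card_mono) (auto simp: V_def)
  moreover have "card {b, d} = 2" using abcd by simp
  ultimately show ?thesis by auto
qed

lemma cycle4_exceptional: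
  assumes alt: "alternating_4cycle G a b c d" and ad: "(a, d) \<in> parcs G" and bc: "(b, c) \<in> parcs G"
    and iso: "no_isolated_verts G"
  shows "(\<exists>m\<ge>2. complete_bipartite_digraph 2 m (with_proj G)) \<or>
    graph_iso G wheel4 \<or> graph_iso G K222"
proof -
  define X where "X = pverts G - {a, b, c, d}"
  note abcd = alt[unfolded alternating_4cycle_def] alternating_4cycle_distinct[OF alt]
  have sub: "{a, b, c, d} \<subseteq> pverts G" by (rule alternating_4cycle_verts[OF alt])
  have verts: "pverts G = {a, b, c, d} \<union> X" using sub by (auto simp: X_def)
  have alt': "alternating_4cycle G b a d c" by (rule alternating_4cycle_rotate(1)[OF alt])
  have ad': "(b, c) \<in> parcs G" and bc': "(a, d) \<in> parcs G" using ad bc by auto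
  consider "\<forall>x\<in>X. (x, b) \<notin> parcs G" | "\<forall>x\<in>X. (x, a) \<notin> parcs G"
    | x y where "x \<in> X" "y \<in> X" "(x, a) \<in> parcs G" "(y, b) \<in> parcs G"
    by blast
  then show ?thesis
  proof cases
    case 1
    then show ?thesis
      using cycle4_complete_bipartite[OF alt ad bc iso] by (auto simp: X_def)
  next
    case 2
    then show ?thesis
      using cycle4_complete_bipartite[OF alt' ad' bc' iso] by (auto simp: X_def)
  next
    case (3 x y)
    \<comment> \<open>An outer \<open>z\<close> seeing only one opposite pair would, by uniformity,
      contradict either \<open>y\<close> seeing \<open>b\<close> or \<open>x\<close> seeing
      \<open>a\<close>.\<close>
    have ab: "(z, a) \<in> parcs G \<and> (z, b) \<in> parcs G" if "z \<in> X" for z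
    proof -
      have z: "z \<in> pverts G" "z \<notin> {a, b, c, d}" "z \<notin> {b, a, d, c}" using that by (auto simp: X_def)
      have xy: "x \<notin> {b, a, d, c}" "y \<notin> {a, b, c, d}" using 3 by (auto simp: X_def)
      show ?thesis
        using outside_cases[OF alt iso z(1,2)] 3
          cycle4_outside_uniform[OF alt ad bc z(2) _ _ xy(2)]
          cycle4_outside_uniform[OF alt' ad' bc' z(3) _ _ xy(1)] by blast
    qed
    have all: "(a, z) \<in> parcs G \<and> (b, z) \<in> parcs G \<and> (c, z) \<in> parcs G \<and> (d, z) \<in> parcs G \<and>
        z \<notin> {a, b, c, d}" if "z \<in> X" for z
      using ab[OF that] outside_adj_iff[OF alt, of z] that adj_sym by (auto simp: X_def)
    note xall = all[OF \<open>x \<in> X\<close>]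
    show ?thesis
    proof (cases "X = {x}")
      case True
      have "graph_iso G wheel4"
        unfolding wheel4_def using abcd ad bc xall True
        by (intro graph_iso_graph_onI[of "[a, b, c, d, x]"])
          (auto simp: irrefl_def verts less_Suc_eq numeral_eq_Suc)
      then show ?thesis by blast
    next
      case False
      then obtain w where w: "w \<in> X" "w \<noteq> x" using \<open>x \<in> X\<close> by blast
      note wall = all[OF w(1)]
      have xw: "(x, w) \<notin> parcs G" using outside_independent[OF alt] xall wall by blast
      then have alt2: "alternating_4cycle G a x c w"
        using abcd xall wall w by (simp add: alternating_4cycle_def)
      \<comment> \<open>A third outer vertex would be adjacent to \<open>b\<close>, and both lie
        outside the alternating 4-cycle \<open>a x c w\<close>.\<close>
      have "z \<in> {x, w}" if z: "z \<in> X" for z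
      proof (rule ccontr)
        assume "z \<notin> {x, w}"
        then have "z \<notin> {a, x, c, w}" "b \<notin> {a, x, c, w}"
          using all[OF z] xall wall abcd by auto
        then show False using outside_independent[OF alt2] all[OF z] by blast
      qed
      then have "X = {x, w}" using w \<open>x \<in> X\<close> by blast
      then have "graph_iso G K222"
        unfolding K222_def using abcd ad bc xall wall xw w
        \<comment> \<open>The three classes of \<open>K222\<close> are the non-adjacent pairs
          \<open>ac\<close>, \<open>bd\<close> and \<open>xw\<close>.\<close>
        by (intro graph_iso_graph_onI[of "[a, c, b, d, x, w]"])
          (auto simp: irrefl_def verts less_Suc_eq numeral_eq_Suc adj_sym[of c b])
      then show ?thesis by blast
    qed
  qed
qed

section \<open>Alternating 4-cycles that do not induce a 4-cycle\<close>

text \<open>If \<open>x\<close> saw only one of the pairs \<open>a, c\<close> and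
  \<open>b, d\<close>, it could replace a vertex of the cycle. The replaced vertex then lies outside
  a new alternating 4-cycle and must see both or neither of two opposite vertices there, which the
  edges and non-edges among \<open>a, b, c, d\<close> rule out.\<close>

lemma outside_dominating:
  assumes alt: "alternating_4cycle G a b c d" and ad: "(a, d) \<notin> parcs G"
    and iso: "no_isolated_verts G" and x: "x \<in> pverts G" "x \<notin> {a, b, c, d}"
  shows "(a, x) \<in> parcs G \<and> (b, x) \<in> parcs G \<and> (c, x) \<in> parcs G \<and> (d, x) \<in> parcs G"
proof -
  note abcd = alt[unfolded alternating_4cycle_def] alternating_4cycle_distinct[OF alt]
  note xac = outside_adj_iff(1)[OF alt x(2)] and xbd = outside_adj_iff(2)[OF alt x(2)]
  have "(x, b) \<in> parcs G"
  proof (rule ccontr)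
    assume nb: "(x, b) \<notin> parcs G"
    then have xa: "(x, a) \<in> parcs G" "(x, c) \<in> parcs G"
      using outside_cases[OF alt iso x] xac by auto
    \<comment> \<open>Here \<open>x\<close> replaces \<open>d\<close>; the equivalence is absurd
      because \<open>cd\<close> is an edge and \<open>ad\<close> is not.\<close>
    have "(d, a) \<in> parcs G \<longleftrightarrow> (d, c) \<in> parcs G"
    proof (cases "(b, c) \<in> parcs G")
      case True
      then have "alternating_4cycle G a b c x"
        using abcd nb x xa by (auto simp: alternating_4cycle_def adj_sym)
      then show ?thesis using abcd x by (intro outside_adj_iff(1)) auto
    next
      case False
      then have "alternating_4cycle G b a x c"
        using abcd nb x xa by (auto simp: alternating_4cycle_def adj_sym)
      then show ?thesis using abcd x by (intro outside_adj_iff(2)) auto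
    qed
    then show False using abcd ad adj_sym by blast
  qed
  moreover have "(x, a) \<in> parcs G"
  proof (rule ccontr)
    assume na: "(x, a) \<notin> parcs G"
    have xb: "(x, b) \<in> parcs G" "(x, d) \<in> parcs G" "(x, c) \<notin> parcs G"
      using \<open>(x, b) \<in> parcs G\<close> na xac xbd by auto
    \<comment> \<open>Now \<open>x\<close> sees exactly \<open>b\<close> and \<open>d\<close>. It
      replaces \<open>a\<close> if \<open>bc\<close> is an edge, as \<open>a\<close> sees
      \<open>b\<close> but not \<open>d\<close>; otherwise it replaces \<open>c\<close>, which sees
      \<open>d\<close> but not \<open>b\<close>.\<close>
    show False
    proof (cases "(b, c) \<in> parcs G")
      case True
      then have "alternating_4cycle G x b c d"
        using abcd x xb by (auto simp: alternating_4cycle_def adj_sym)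
      then have "(a, b) \<in> parcs G \<longleftrightarrow> (a, d) \<in> parcs G"
        using abcd x by (intro outside_adj_iff(2)) auto
      then show False using abcd ad by blast
    next
      case False
      then have "alternating_4cycle G a b x d"
        using abcd x na xb by (auto simp: alternating_4cycle_def adj_sym)
      then have "(c, b) \<in> parcs G \<longleftrightarrow> (c, d) \<in> parcs G"
        using abcd x by (intro outside_adj_iff(2)) auto
      then show False using abcd False adj_sym by blast
    qed
  qed
  ultimately show ?thesis using xac xbd adj_sym by blast
qed

text \<open>There is at most one outer vertex, and it is adjacent to all of
  \<open>a, b, c, d\<close>. Its presence and the status of \<open>bc\<close> select one of the four
  graphs.\<close>

lemma non_cycle4_exceptional:
  assumes alt: "alternating_4cycle G a b c d" and ad: "(a, d) \<notin> parcs G"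
    and iso: "no_isolated_verts G"
  shows "graph_iso G path4 \<or> graph_iso G gem \<or> graph_iso G two_K2 \<or> graph_iso G bowtie"
proof -
  define X where "X = pverts G - {a, b, c, d}"
  note abcd = alt[unfolded alternating_4cycle_def] alternating_4cycle_distinct[OF alt]
  have verts: "pverts G = {a, b, c, d} \<union> X"
    using alternating_4cycle_verts[OF alt] by (auto simp: X_def)
  have all: "(a, x) \<in> parcs G \<and> (b, x) \<in> parcs G \<and> (c, x) \<in> parcs G \<and> (d, x) \<in> parcs G \<and>
      x \<notin> {a, b, c, d}" if "x \<in> X" for x
    using outside_dominating[OF alt ad iso, of x] that by (auto simp: X_def)
  \<comment> \<open>Two outer vertices would give the alternating 4-cycle \<open>a x c y\<close>,
    outside which \<open>d\<close> sees \<open>c\<close> but not \<open>a\<close>.\<close>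
  have one: "x = y" if "x \<in> X" "y \<in> X" for x y
  proof (rule ccontr)
    assume ne: "x \<noteq> y"
    note xall = all[OF that(1)] and yall = all[OF that(2)]
    have "(x, y) \<notin> parcs G" using outside_independent[OF alt] xall yall by blast
    then have "alternating_4cycle G a x c y"
      using abcd xall yall ne by (simp add: alternating_4cycle_def)
    then have "(d, a) \<in> parcs G \<longleftrightarrow> (d, c) \<in> parcs G"
      using abcd xall yall by (intro outside_adj_iff(1)) auto
    then show False using abcd ad adj_sym by blast
  qed
  show ?thesis
  proof (cases "X = {}")
    case True
    note facts = abcd ad True
    show ?thesis
    proof (cases "(b, c) \<in> parcs G")
      case bc: True
      have "graph_iso G path4"
        unfolding path4_def using facts bc
        by (intro graph_iso_graph_onI[of "[a, b, c, d]"])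
          (auto simp: irrefl_def verts less_Suc_eq numeral_eq_Suc)
      then show ?thesis by blast
    next
      case bc: False
      have "graph_iso G two_K2"
        unfolding two_K2_def using facts bc
        by (intro graph_iso_graph_onI[of "[a, b, c, d]"])
          (auto simp: irrefl_def verts less_Suc_eq numeral_eq_Suc)
      then show ?thesis by blast
    qed
  next
    case False
    then obtain x where x: "X = {x}" using one by blast
    note facts = abcd ad all[of x] x
    show ?thesis
    proof (cases "(b, c) \<in> parcs G")
      case bc: True
      have "graph_iso G gem"
        unfolding gem_def using facts bc
        by (intro graph_iso_graph_onI[of "[a, b, c, d, x]"])
          (auto simp: irrefl_def verts less_Suc_eq numeral_eq_Suc)
      then show ?thesis by blast
    next
      case bc: False
      have "graph_iso G bowtie"
        unfolding bowtie_def using facts bc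
        by (intro graph_iso_graph_onI[of "[a, b, c, d, x]"])
          (auto simp: irrefl_def verts less_Suc_eq numeral_eq_Suc)
      then show ?thesis by blast
    qed
  qed
qed

section \<open>Classification and the equivalence\<close>

lemma exceptional_or_threshold:
  assumes iso: "no_isolated_verts G"
  shows "threshold_graph G \<or> (\<exists>m\<ge>2. complete_bipartite_digraph 2 m (with_proj G)) \<or>
    graph_iso G wheel4 \<or> graph_iso G K222 \<or> graph_iso G two_K2 \<or> graph_iso G path4 \<or>
    graph_iso G gem \<or> graph_iso G bowtie"
proof (cases "threshold_graph G")
  case False
  then obtain a b c d where alt: "alternating_4cycle G a b c d"
    by (auto simp: threshold_graph_iff_no_alternating_4cycle)
  consider "(a, d) \<in> parcs G" "(b, c) \<in> parcs G" | "(a, d) \<notin> parcs G" | "(b, c) \<notin> parcs G"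
    by blast
  then show ?thesis
  proof cases
    case 1
    then show ?thesis using cycle4_exceptional[OF alt _ _ iso] by blast
  next
    case 2
    then show ?thesis using non_cycle4_exceptional[OF alt _ iso] by blast
  next
    \<comment> \<open>The first symmetry puts \<open>bc\<close> in the position of
      \<open>ad\<close>, so the previous case applies.\<close>
    case 3
    then show ?thesis
      using non_cycle4_exceptional[OF alternating_4cycle_rotate(1)[OF alt] _ iso] by blast
  qed
qed simp

end

theorem theorem41:
  fixes G :: "'a pair_pre_digraph"
  assumes "pair_graph G"
    and "no_isolated_verts G"
    and "\<not> has_induced cycle5 G"
    and "\<And>m. m \<ge> 2 \<Longrightarrow> \<not> complete_bipartite_digraph 2 m (with_proj G)"
    and "\<not> graph_iso G wheel4"
    and "\<not> graph_iso G K222"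
    and "\<not> graph_iso G two_K2"
    and "\<not> graph_iso G path4"
    and "\<not> graph_iso G gem"
    and "\<not> graph_iso G bowtie"
  shows "threshold_graph G \<longleftrightarrow>
         (\<forall>(u, v) \<in> parcs G. threshold_graph (contract_edge G u v))"
proof -
  interpret pair_graph G by fact
  show ?thesis
  proof
    assume "threshold_graph G"
    then show "\<forall>(u, v) \<in> parcs G. threshold_graph (contract_edge G u v)"
      using threshold_contract_edge by auto
  next
    assume "\<forall>(u, v) \<in> parcs G. threshold_graph (contract_edge G u v)"
    then interpret contractions_threshold G by unfold_locales auto
    show "threshold_graph G"
      using exceptional_or_threshold assms by blast
  qed
qed

end
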